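(* Within the class of acknowledgement-based protocols, and within the class of ternary feedback protocols, with $k\ge2$ channels and $n\ge2$ players, there exists no equilibrium protocol with blocking step that has finite expected latency.
   Context: Contention game: $n$ players, channel set $K=\{1,\dots,k\}$, discrete slots $t=1,2,\dots$; each player has one packet and is initially pending. In each slot a pending player chooses (possibly at random) an action in $\{0,1,\dots,k\}$ ($0$ = no transmission, $a$ = transmit on channel $a$). A lone transmitter on a channel succeeds and leaves; two or more transmitters on a channel collide and remain pending. Latency $T_i$ = slot of player $i$'s successful transmission; players minimize expected latency. Acknowledgement-based feedback: only a player who attempted transmission learns whether she succeeded, and decision rules depend only on the personal action history. Ternary feedback: additionally every pending player learns the number of pending players in every slot. Anonymous protocol: common protocol whose decision rules do not depend on identity (players with equal histories get equal decision rules). Equilibrium protocol: when all players use it, no player at any slot and after any history can decrease her conditional expected latency by unilaterally deviating. An equilibrium with blocking step (EBS) is an anonymous equilibrium protocol for which there exists a finite time-step at which every pending player has probability $0$ of successful transmission. *)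

theory Defs
  imports "HOL-Probability.Probability"
begin

text \<open>Players are 0,...,n-1. Actions are naturals: 0 = silent, a in 1..k = transmit on channel a.
  A state records, for every player, Some h (pending, with personal history h) or None
  (already succeeded and left). A profile assigns to each player a decision rule mapping
  her personal history to a distribution over actions.\<close>

type_synonym 'o state = "nat \<Rightarrow> 'o list option"
type_synonym 'o profile = "nat \<Rightarrow> 'o list \<Rightarrow> nat pmf"

text \<open>Per-slot observation of a pending player, given her action and the number of players
  still pending after the slot. Acknowledgement-based: only the own action (a pending player
  who transmitted knows she failed). Ternary: additionally the number of pending players.\<close>

definition obs_ack :: "nat \<Rightarrow> nat \<Rightarrow> nat" where
  "obs_ack a m = a"

definition obs_tern :: "nat \<Rightarrow> nat \<Rightarrow> nat \<times> nat" where
  "obs_tern a m = (a, m)"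

definition init_state :: "nat \<Rightarrow> 'o state" where
  "init_state n = (\<lambda>i. if i < n then Some [] else None)"

definition pending :: "nat \<Rightarrow> 'o state \<Rightarrow> nat set" where
  "pending n st = {i. i < n \<and> st i \<noteq> None}"

definition succeeds :: "nat set \<Rightarrow> (nat \<Rightarrow> nat) \<Rightarrow> nat \<Rightarrow> bool" where
  "succeeds A a i \<longleftrightarrow> i \<in> A \<and> a i \<noteq> 0 \<and> (\<forall>j\<in>A. j \<noteq> i \<longrightarrow> a j \<noteq> a i)"

definition next_state :: "(nat \<Rightarrow> nat \<Rightarrow> 'o) \<Rightarrow> nat \<Rightarrow> 'o state \<Rightarrow> (nat \<Rightarrow> nat) \<Rightarrow> 'o state" where
  "next_state obs n st a =
     (let A = pending n st; m = card {j \<in> A. \<not> succeeds A a j}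
      in (\<lambda>i. if i \<in> A \<and> \<not> succeeds A a i then Some (the (st i) @ [obs (a i) m]) else None))"

definition step :: "(nat \<Rightarrow> nat \<Rightarrow> 'o) \<Rightarrow> nat \<Rightarrow> 'o profile \<Rightarrow> 'o state \<Rightarrow> 'o state pmf" where
  "step obs n P st = map_pmf (next_state obs n st) (Pi_pmf (pending n st) 0 (\<lambda>i. P i (the (st i))))"

text \<open>Distribution of the path of states after t slots; element s of the path (s \<le> t) is
  the state after s slots, i.e. at the beginning of slot s+1.\<close>
fun paths :: "(nat \<Rightarrow> nat \<Rightarrow> 'o) \<Rightarrow> nat \<Rightarrow> 'o profile \<Rightarrow> nat \<Rightarrow> 'o state list pmf" where
  "paths obs n P 0 = return_pmf [init_state n]"
| "paths obs n P (Suc t) =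
     bind_pmf (paths obs n P t) (\<lambda>p. map_pmf (\<lambda>s. p @ [s]) (step obs n P (last p)))"

text \<open>Expected latency E[T_i] = sum over s \<ge> 0 of P(T_i > s) (tail-sum formula, in ennreal,
  so it may be infinite); T_i > s iff player i is still pending after s slots.\<close>
definition expected_latency :: "(nat \<Rightarrow> nat \<Rightarrow> 'o) \<Rightarrow> nat \<Rightarrow> 'o profile \<Rightarrow> nat \<Rightarrow> ennreal" where
  "expected_latency obs n P i =
     (\<Sum>s. ennreal (measure_pmf.prob (paths obs n P s) {p. (p ! s) i \<noteq> None}))"

definition cond_latency :: "(nat \<Rightarrow> nat \<Rightarrow> 'o) \<Rightarrow> nat \<Rightarrow> 'o profile \<Rightarrow> nat \<Rightarrow> nat \<Rightarrow> 'o list \<Rightarrow> ennreal" where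
  "cond_latency obs n P i r h =
     (\<Sum>s. ennreal (measure_pmf.prob (paths obs n P (s + r)) {p. (p ! s) i \<noteq> None \<and> (p ! r) i = Some h}))
     / ennreal (measure_pmf.prob (paths obs n P r) {p. (p ! r) i = Some h})"

definition valid_rule :: "nat \<Rightarrow> ('o list \<Rightarrow> nat pmf) \<Rightarrow> bool" where
  "valid_rule k \<sigma> \<longleftrightarrow> (\<forall>h. set_pmf (\<sigma> h) \<subseteq> {0..k})"

definition deviate :: "('o list \<Rightarrow> nat pmf) \<Rightarrow> ('o list \<Rightarrow> nat pmf) \<Rightarrow> nat \<Rightarrow> 'o list \<Rightarrow> nat pmf" where
  "deviate \<pi> \<sigma> r = (\<lambda>h. if length h < r then \<pi> h else \<sigma> h)"

definition is_equilibrium :: "(nat \<Rightarrow> nat \<Rightarrow> 'o) \<Rightarrow> nat \<Rightarrow> nat \<Rightarrow> ('o list \<Rightarrow> nat pmf) \<Rightarrow> bool" where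
  "is_equilibrium obs n k \<pi> \<longleftrightarrow>
     valid_rule k \<pi> \<and>
     (\<forall>i<n. \<forall>r h \<sigma>. valid_rule k \<sigma> \<longrightarrow>
        measure_pmf.prob (paths obs n (\<lambda>_. \<pi>) r) {p. (p ! r) i = Some h} > 0 \<longrightarrow>
        cond_latency obs n (\<lambda>_. \<pi>) i r h
          \<le> cond_latency obs n ((\<lambda>_. \<pi>)(i := deviate \<pi> \<sigma> r)) i r h)"

definition has_blocking_step :: "(nat \<Rightarrow> nat \<Rightarrow> 'o) \<Rightarrow> nat \<Rightarrow> ('o list \<Rightarrow> nat pmf) \<Rightarrow> bool" where
  "has_blocking_step obs n \<pi> \<longleftrightarrow>
     (\<exists>r. measure_pmf.prob (paths obs n (\<lambda>_. \<pi>) r) {p. \<exists>i<n. (p ! r) i \<noteq> None} > 0 \<and>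
          (\<forall>i<n. measure_pmf.prob (paths obs n (\<lambda>_. \<pi>) (Suc r))
                   {p. (p ! r) i \<noteq> None \<and> (p ! Suc r) i = None} = 0))"

definition is_EBS :: "(nat \<Rightarrow> nat \<Rightarrow> 'o) \<Rightarrow> nat \<Rightarrow> nat \<Rightarrow> ('o list \<Rightarrow> nat pmf) \<Rightarrow> bool" where
  "is_EBS obs n k \<pi> \<longleftrightarrow> is_equilibrium obs n k \<pi> \<and> has_blocking_step obs n \<pi>"

end

theory Submission
  imports Defs
begin

text \<open>Suppose that slot \<open>r + 1\<close> blocks, and consider a reachable state in which at least two players are
  pending, all with the same history \<open>h\<close>. Their actions are independent and identically distributed,
  so a genuinely random action would let one of them succeed with positive probability; hence the rule
  at \<open>h\<close> plays a fixed action \<open>a\<close>, and a player holding \<open>h\<close> can deviate to a channel \<open>c \<noteq> a\<close>.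

  With acknowledgements only, take the state in which all \<open>n\<close> players have made the same choices. Given
  \<open>h\<close> the other players may be in a different state, but a failed deviator who goes on as if she had
  played \<open>a\<close> loses nothing: the others cannot detect the deviation, and early successes of others only
  help her. So she gains strictly.

  With ternary feedback a failed deviation may be noticed, and it can be punished off the equilibrium
  path, so the state has to be chosen such that the deviation cannot fail: \<open>h\<close> must reveal that all
  pending players hold \<open>h\<close>. Such a state is carried along slot by slot. If \<open>S\<close> is the set of possible
  actions at \<open>h\<close>, let as many players as possible, but leaving at least two, succeed on distinct
  channels of \<open>S - {z}\<close> while the others all choose \<open>z\<close>, where \<open>z = 0\<close> if \<open>0 \<in> S\<close>; then the number
  of pending players tells each remaining player that all of them chose \<open>z\<close>.\<close>

section \<open>The path measure\<close>

definition joint_action :: "nat \<Rightarrow> 'o profile \<Rightarrow> 'o state \<Rightarrow> (nat \<Rightarrow> nat) pmf" where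
  "joint_action n P st = Pi_pmf (pending n st) 0 (\<lambda>i. P i (the (st i)))"

lemma step_eq: "step obs n P st = map_pmf (next_state obs n st) (joint_action n P st)"
  by (simp add: step_def joint_action_def)

lemma finite_pending [simp]: "finite (pending n st)"
  by (simp add: pending_def)

lemma set_joint_action:
  "set_pmf (joint_action n P st) =
     {a. (\<forall>i\<in>pending n st. a i \<in> set_pmf (P i (the (st i)))) \<and> (\<forall>i. i \<notin> pending n st \<longrightarrow> a i = 0)}"
  by (auto simp: joint_action_def set_Pi_pmf PiE_dflt_def)

lemma next_state_apply:
  "next_state obs n st a i =
     (if i \<in> pending n st \<and> \<not> succeeds (pending n st) a i
      then Some (the (st i) @ [obs (a i) (card {j \<in> pending n st. \<not> succeeds (pending n st) a j})])
      else None)"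
  by (simp add: next_state_def Let_def)

lemma length_paths: "p \<in> set_pmf (paths obs n P t) \<Longrightarrow> length p = Suc t"
  by (induction t arbitrary: p) auto

lemma last_paths: "p \<in> set_pmf (paths obs n P t) \<Longrightarrow> last p = p ! t"
  using length_paths[of p obs n P t] by (cases p rule: rev_cases) auto

text \<open>Later slots only append to a path, so the path laws for different horizons are
  consistent.\<close>

lemma map_take_paths: "map_pmf (take (Suc t)) (paths obs n P (t + u)) = paths obs n P t"
proof (induction u)
  case 0
  have "map_pmf (take (Suc t)) (paths obs n P t) = map_pmf id (paths obs n P t)"
    by (rule map_pmf_cong) (auto dest: length_paths)
  then show ?case by simp
next
  case (Suc u)
  have "map_pmf (take (Suc t)) (paths obs n P (t + Suc u)) =
     bind_pmf (paths obs n P (t + u)) (\<lambda>p. map_pmf (\<lambda>s. take (Suc t) (p @ [s])) (step obs n P (last p)))"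
    by (simp add: map_bind_pmf map_pmf_comp o_def)
  also have "\<dots> = bind_pmf (paths obs n P (t + u)) (\<lambda>p. return_pmf (take (Suc t) p))"
    by (rule bind_pmf_cong) (auto dest!: length_paths)
  also have "\<dots> = map_pmf (take (Suc t)) (paths obs n P (t + u))"
    by (simp add: map_pmf_def)
  finally show ?case using Suc.IH by simp
qed

text \<open>The horizon \<open>s + r\<close> in \<open>cond_latency\<close> merely covers both
  times; this allows it to be shortened to the later one.\<close>

lemma prob_paths_truncate:
  assumes "s \<le> t" "r \<le> t"
  shows "measure_pmf.prob (paths obs n P (t + u)) {p. Q (p ! s) (p ! r)} =
         measure_pmf.prob (paths obs n P t) {p. Q (p ! s) (p ! r)}"
proof -
  have "measure_pmf.prob (paths obs n P t) {p. Q (p ! s) (p ! r)} =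
        measure_pmf.prob (map_pmf (take (Suc t)) (paths obs n P (t + u))) {p. Q (p ! s) (p ! r)}"
    by (simp only: map_take_paths)
  also have "\<dots> = measure_pmf.prob (paths obs n P (t + u)) {p. Q (p ! s) (p ! r)}"
    using assms by (simp add: vimage_def)
  finally show ?thesis by simp
qed

section \<open>Reachable states\<close>

definition reach :: "(nat \<Rightarrow> nat \<Rightarrow> 'o) \<Rightarrow> nat \<Rightarrow> 'o profile \<Rightarrow> nat \<Rightarrow> 'o state set" where
  "reach obs n P t = last ` set_pmf (paths obs n P t)"

lemma reach_0: "reach obs n P 0 = {init_state n}"
  by (simp add: reach_def)

lemma reach_Suc:
  "reach obs n P (Suc t) =
     {next_state obs n st a | st a. st \<in> reach obs n P t \<and> a \<in> set_pmf (joint_action n P st)}"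
  by (force simp: reach_def step_eq)

text \<open>Every slot adds exactly one observation, so the length of a history is the clock that
  \<open>deviate\<close> reads.\<close>

lemma reach_history:
  assumes "st \<in> reach obs n P t" "st i = Some h"
  shows "length h = t \<and> i < n"
  using assms
proof (induction t arbitrary: st i h)
  case 0
  then show ?case by (auto simp: reach_0 init_state_def split: if_splits)
next
  case (Suc t)
  then obtain st' a where st': "st' \<in> reach obs n P t" "st = next_state obs n st' a"
    by (auto simp: reach_Suc)
  with Suc.prems(2) have "i \<in> pending n st'" and
    h: "h = the (st' i) @ [obs (a i) (card {j \<in> pending n st'. \<not> succeeds (pending n st') a j})]"
    by (auto simp: next_state_apply split: if_splits)
  then obtain h' where "st' i = Some h'" "i < n" by (auto simp: pending_def)
  with Suc.IH[OF st'(1)] h show ?case by simp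
qed

text \<open>The first \<open>r\<close> slots consult only histories shorter than \<open>r\<close>.
  Hence a history at time \<open>r\<close> has the same weight with and without the
  deviation.\<close>

lemma paths_deviate:
  assumes "t \<le> r"
  shows "paths obs n ((\<lambda>_. \<pi>)(i := deviate \<pi> \<sigma> r)) t = paths obs n (\<lambda>_. \<pi>) t"
  using assms
proof (induction t)
  case (Suc t)
  have "step obs n ((\<lambda>_. \<pi>)(i := deviate \<pi> \<sigma> r)) (last p) = step obs n (\<lambda>_. \<pi>) (last p)"
    if "p \<in> set_pmf (paths obs n (\<lambda>_. \<pi>) t)" for p
  proof -
    have "last p \<in> reach obs n (\<lambda>_. \<pi>) t" using that by (simp add: reach_def)
    then have "length (the (last p j)) < r" if "j \<in> pending n (last p)" for j
      using reach_history[of "last p" obs n "\<lambda>_. \<pi>" t j] that Suc.prems by (auto simp: pending_def)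
    then have "joint_action n ((\<lambda>_. \<pi>)(i := deviate \<pi> \<sigma> r)) (last p) = joint_action n (\<lambda>_. \<pi>) (last p)"
      unfolding joint_action_def by (intro Pi_pmf_cong) (auto simp: deviate_def)
    then show ?thesis by (simp add: step_eq)
  qed
  then have "paths obs n ((\<lambda>_. \<pi>)(i := deviate \<pi> \<sigma> r)) (Suc t) =
    bind_pmf (paths obs n (\<lambda>_. \<pi>) t) (\<lambda>p. map_pmf (\<lambda>s. p @ [s]) (step obs n (\<lambda>_. \<pi>) (last p)))"
    using Suc by (simp del: fun_upd_apply cong: bind_pmf_cong)
  then show ?case by (simp only: paths.simps)
qed simp

section \<open>Survival probabilities and profitable deviations\<close>

text \<open>The probability that player \<open>i\<close> is still pending \<open>u\<close> slots
  after state \<open>st\<close>, by recursion on the first slot.\<close>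

primrec surv :: "(nat \<Rightarrow> nat \<Rightarrow> 'o) \<Rightarrow> nat \<Rightarrow> 'o profile \<Rightarrow> nat \<Rightarrow> nat \<Rightarrow> 'o state \<Rightarrow> ennreal" where
  "surv obs n P i 0 st = (if st i = None then 0 else 1)"
| "surv obs n P i (Suc u) st =
     (\<integral>\<^sup>+ a. surv obs n P i u (next_state obs n st a) \<partial>measure_pmf (joint_action n P st))"

lemma surv_le_1: "surv obs n P i u st \<le> 1"
proof (induction u arbitrary: st)
  case (Suc u)
  have "surv obs n P i (Suc u) st \<le> (\<integral>\<^sup>+ a. 1 \<partial>measure_pmf (joint_action n P st))"
    unfolding surv.simps by (intro nn_integral_mono Suc)
  then show ?case by (simp add: measure_pmf.emeasure_space_1)
qed simp

lemma surv_departed: "st i = None \<Longrightarrow> surv obs n P i u st = 0"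
  by (induction u arbitrary: st) (simp_all add: next_state_apply pending_def)

text \<open>Markov property at time \<open>r\<close>: the last slot of the path is traded for one
  more slot in \<open>surv\<close>. The index \<open>v\<close> grows with each trade, so it must
  vary in the induction.\<close>

lemma nn_integral_paths_surv:
  "(\<integral>\<^sup>+ p. G (p ! r) * surv obs n P i v (last p) \<partial>measure_pmf (paths obs n P (r + u))) =
   (\<integral>\<^sup>+ p. G (p ! r) * surv obs n P i (v + u) (last p) \<partial>measure_pmf (paths obs n P r))"
proof (induction u arbitrary: v)
  case (Suc u)
  have "(\<integral>\<^sup>+ p. G (p ! r) * surv obs n P i v (last p) \<partial>measure_pmf (paths obs n P (r + Suc u))) =
    (\<integral>\<^sup>+ p. (\<integral>\<^sup>+ a. G ((p @ [next_state obs n (last p) a]) ! r) *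
        surv obs n P i v (next_state obs n (last p) a) \<partial>measure_pmf (joint_action n P (last p)))
      \<partial>measure_pmf (paths obs n P (r + u)))"
    by (simp add: step_eq)
  also have "\<dots> = (\<integral>\<^sup>+ p. G (p ! r) * surv obs n P i (Suc v) (last p) \<partial>measure_pmf (paths obs n P (r + u)))"
  proof (intro nn_integral_cong_AE, unfold AE_measure_pmf_iff, intro ballI)
    fix p assume "p \<in> set_pmf (paths obs n P (r + u))"
    then have "length p = Suc (r + u)" by (rule length_paths)
    then show "(\<integral>\<^sup>+ a. G ((p @ [next_state obs n (last p) a]) ! r) *
        surv obs n P i v (next_state obs n (last p) a) \<partial>measure_pmf (joint_action n P (last p))) =
        G (p ! r) * surv obs n P i (Suc v) (last p)"
      by (simp add: nth_append nn_integral_cmult)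
  qed
  also have "\<dots> = (\<integral>\<^sup>+ p. G (p ! r) * surv obs n P i (v + Suc u) (last p) \<partial>measure_pmf (paths obs n P r))"
    using Suc.IH[of "Suc v"] by simp
  finally show ?case .
qed simp

text \<open>The summands of the numerator of \<open>cond_latency\<close>: up to \<open>s = r\<close>
  they depend on the common past alone, afterwards they are averages of \<open>surv\<close>.\<close>

definition pending_prob ::
  "(nat \<Rightarrow> nat \<Rightarrow> 'o) \<Rightarrow> nat \<Rightarrow> 'o profile \<Rightarrow> nat \<Rightarrow> nat \<Rightarrow> 'o list \<Rightarrow> nat \<Rightarrow> ennreal" where
  "pending_prob obs n P i r h s =
     ennreal (measure_pmf.prob (paths obs n P (s + r)) {p. (p ! s) i \<noteq> None \<and> (p ! r) i = Some h})"

lemma pending_prob_before: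
  assumes "s \<le> r"
  shows "pending_prob obs n P i r h s =
    ennreal (measure_pmf.prob (paths obs n P r) {p. (p ! s) i \<noteq> None \<and> (p ! r) i = Some h})"
  using prob_paths_truncate[of s r r obs n P s "\<lambda>x y. x i \<noteq> None \<and> y i = Some h"] assms
  by (simp add: pending_prob_def add.commute)

lemma pending_prob_after:
  "pending_prob obs n P i r h (r + u) =
     (\<integral>\<^sup>+ p. (if last p i = Some h then 1 else 0) * surv obs n P i u (last p) \<partial>measure_pmf (paths obs n P r))"
proof -
  have "pending_prob obs n P i r h (r + u) =
    ennreal (measure_pmf.prob (paths obs n P (r + u)) {p. (p ! (r + u)) i \<noteq> None \<and> (p ! r) i = Some h})"
    using prob_paths_truncate[of "r + u" "r + u" r obs n P r "\<lambda>x y. x i \<noteq> None \<and> y i = Some h"]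
    by (simp add: pending_prob_def)
  also have "\<dots> = (\<integral>\<^sup>+ p. indicator {p. (p ! (r + u)) i \<noteq> None \<and> (p ! r) i = Some h} p
      \<partial>measure_pmf (paths obs n P (r + u)))"
    by (simp add: measure_pmf.emeasure_eq_measure)
  also have "\<dots> = (\<integral>\<^sup>+ p. (if (p ! r) i = Some h then 1 else 0) * surv obs n P i 0 (last p)
      \<partial>measure_pmf (paths obs n P (r + u)))"
    by (intro nn_integral_cong_AE) (auto simp: AE_measure_pmf_iff last_paths indicator_def)
  also have "\<dots> = (\<integral>\<^sup>+ p. (if (p ! r) i = Some h then 1 else 0) * surv obs n P i u (last p)
      \<partial>measure_pmf (paths obs n P r))"
    using nn_integral_paths_surv[where G = "\<lambda>st. if st i = Some h then 1 else 0" and v = 0] by simp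
  also have "\<dots> = (\<integral>\<^sup>+ p. (if last p i = Some h then 1 else 0) * surv obs n P i u (last p)
      \<partial>measure_pmf (paths obs n P r))"
    by (intro nn_integral_cong_AE) (auto simp: AE_measure_pmf_iff last_paths)
  finally show ?thesis .
qed

text \<open>A series is an integral for counting measure, where strictness at one point suffices
  once the smaller integral is finite.\<close>

lemma suminf_ennreal_strict_mono:
  fixes f g :: "nat \<Rightarrow> ennreal"
  assumes "\<And>s. f s \<le> g s" "f t < g t" "(\<Sum>s. g s) < \<infinity>"
  shows "(\<Sum>s. f s) < (\<Sum>s. g s)"
proof -
  have "(\<Sum>s. f s) \<le> (\<Sum>s. g s)" using assms(1) by (intro suminf_le) auto
  with assms(3) have "(\<Sum>s. f s) \<noteq> \<infinity>" by (auto simp: top_unique)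
  then have "(\<integral>\<^sup>+ s. f s \<partial>count_space UNIV) < (\<integral>\<^sup>+ s. g s \<partial>count_space UNIV)"
    using assms by (intro nn_integral_less)
      (auto simp: nn_integral_count_space_nat AE_count_space not_le)
  then show ?thesis by (simp add: nn_integral_count_space_nat)
qed

text \<open>A reachable state holding \<open>h\<close> has positive weight given \<open>h\<close>. A
  strict drop of survival there, with no increase in any state compatible with \<open>h\<close>,
  would strictly lower the conditional latency; finiteness of the expected latency makes this
  comparison strict.\<close>

lemma no_profitable_deviation:
  assumes eq: "is_equilibrium obs n k \<pi>"
    and fin: "expected_latency obs n (\<lambda>_. \<pi>) i < \<infinity>"
    and \<sigma>: "valid_rule k \<sigma>"
    and P': "P' = (\<lambda>_. \<pi>)(i := deviate \<pi> \<sigma> r)"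
    and le: "\<And>st u. st \<in> reach obs n (\<lambda>_. \<pi>) r \<Longrightarrow> st i = Some h \<Longrightarrow>
      surv obs n P' i u st \<le> surv obs n (\<lambda>_. \<pi>) i u st"
    and st: "st \<in> reach obs n (\<lambda>_. \<pi>) r" "st i = Some h"
  shows "surv obs n (\<lambda>_. \<pi>) i u st \<le> surv obs n P' i u st"
proof (rule ccontr)
  let ?P = "\<lambda>_. \<pi>" and ?D = "measure_pmf.prob (paths obs n (\<lambda>_. \<pi>) r) {p. (p ! r) i = Some h}"
  assume "\<not> surv obs n ?P i u st \<le> surv obs n P' i u st"
  moreover obtain p where p: "p \<in> set_pmf (paths obs n ?P r)" "last p = st"
    using st(1) by (auto simp: reach_def)
  ultimately have strict: "\<not> surv obs n ?P i u (last p) \<le> surv obs n P' i u (last p)" by simp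
  have same: "paths obs n P' r = paths obs n ?P r" by (simp add: P' paths_deviate)
  have D: "?D > 0" using p st(2) by (intro measure_pmf_posI[of p]) (auto simp: last_paths)
  have pp_le: "pending_prob obs n P' i r h s \<le> pending_prob obs n ?P i r h s" for s
  proof (cases "s \<le> r")
    case True then show ?thesis by (simp add: pending_prob_before same)
  next
    case False
    then obtain w where "s = r + w" using le_Suc_ex nat_le_linear by blast
    then show ?thesis unfolding pending_prob_after same
      by (auto intro!: nn_integral_mono_AE le simp: pending_prob_after same AE_measure_pmf_iff reach_def)
  qed
  have pp_less: "pending_prob obs n P' i r h (r + u) < pending_prob obs n ?P i r h (r + u)"
    unfolding pending_prob_after same
  proof (rule nn_integral_less)
    have "(\<integral>\<^sup>+ p. (if last p i = Some h then 1 else 0) * surv obs n P' i u (last p) \<partial>measure_pmf (paths obs n ?P r))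
      \<le> (\<integral>\<^sup>+ p. 1 \<partial>measure_pmf (paths obs n ?P r))"
      by (intro nn_integral_mono) (simp add: surv_le_1)
    then show "(\<integral>\<^sup>+ p. (if last p i = Some h then 1 else 0) * surv obs n P' i u (last p) \<partial>measure_pmf (paths obs n ?P r)) \<noteq> \<infinity>"
      by (auto simp: measure_pmf.emeasure_space_1 top_unique)
  next
    show "AE x in measure_pmf (paths obs n ?P r).
       (if last x i = Some h then 1 else 0) * surv obs n P' i u (last x)
         \<le> (if last x i = Some h then 1 else 0) * surv obs n ?P i u (last x)"
      by (auto intro!: le simp: AE_measure_pmf_iff reach_def)
    show "\<not> (AE x in measure_pmf (paths obs n ?P r).
       (if last x i = Some h then 1 else 0) * surv obs n ?P i u (last x)
         \<le> (if last x i = Some h then 1 else 0) * surv obs n P' i u (last x))"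
      using p strict st(2) by (auto simp: AE_measure_pmf_iff)
  qed auto
  \<comment> \<open>Dropping the condition on \<open>h\<close> bounds the numerator by the finite
    tail sum.\<close>
  have "(\<Sum>s. pending_prob obs n ?P i r h s) \<le> expected_latency obs n ?P i"
    unfolding expected_latency_def
  proof (intro suminf_le)
    fix s
    have "pending_prob obs n ?P i r h s \<le> ennreal (measure_pmf.prob (paths obs n ?P (s + r)) {p. (p ! s) i \<noteq> None})"
      unfolding pending_prob_def by (intro ennreal_leI measure_pmf.finite_measure_mono) auto
    also have "\<dots> = ennreal (measure_pmf.prob (paths obs n ?P s) {p. (p ! s) i \<noteq> None})"
      using prob_paths_truncate[of s s s obs n ?P r "\<lambda>x _. x i \<noteq> None"] by simp
    finally show "pending_prob obs n ?P i r h s \<le> \<dots>" .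
  qed auto
  also note fin
  finally have sum_less: "(\<Sum>s. pending_prob obs n P' i r h s) < (\<Sum>s. pending_prob obs n ?P i r h s)"
    using pp_le pp_less by (intro suminf_ennreal_strict_mono) auto
  have "i < n" using reach_history[OF st] by simp
  then have "cond_latency obs n ?P i r h \<le> cond_latency obs n P' i r h"
    using eq \<sigma> D unfolding is_equilibrium_def P' by blast
  then have "(\<Sum>s. pending_prob obs n ?P i r h s) / ennreal ?D \<le> (\<Sum>s. pending_prob obs n P' i r h s) / ennreal ?D"
    unfolding cond_latency_def pending_prob_def same .
  then have "(\<Sum>s. pending_prob obs n ?P i r h s) / ennreal ?D * ennreal ?D
     \<le> (\<Sum>s. pending_prob obs n P' i r h s) / ennreal ?D * ennreal ?D"
    by (rule mult_right_mono) simp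
  moreover have "x / ennreal ?D * ennreal ?D = x" for x
    using D by (simp add: ennreal_divide_times ennreal_times_divide ennreal_mult_divide_eq)
  ultimately show False using sum_less by simp
qed

section \<open>Blocked states in which all pending players have the same history\<close>

definition uniform_state :: "nat set \<Rightarrow> 'o list \<Rightarrow> 'o state" where
  "uniform_state B h = (\<lambda>i. if i \<in> B then Some h else None)"

lemma pending_uniform [simp]: "B \<subseteq> {..<n} \<Longrightarrow> pending n (uniform_state B h) = B"
  by (auto simp: pending_def uniform_state_def)

lemma set_joint_action_uniform:
  assumes "B \<subseteq> {..<n}"
  shows "set_pmf (joint_action n P (uniform_state B h)) =
    {a. (\<forall>i\<in>B. a i \<in> set_pmf (P i h)) \<and> (\<forall>i. i \<notin> B \<longrightarrow> a i = 0)}"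
  unfolding set_joint_action pending_uniform[OF assms] by (auto simp: uniform_state_def)

lemma init_state_uniform: "init_state n = uniform_state {..<n} []"
  by (auto simp: init_state_def uniform_state_def)

definition blocked :: "nat \<Rightarrow> 'o profile \<Rightarrow> 'o state \<Rightarrow> bool" where
  "blocked n P st \<longleftrightarrow> (\<forall>a\<in>set_pmf (joint_action n P st). \<forall>i. \<not> succeeds (pending n st) a i)"

text \<open>In a discrete law an event of probability 0 misses the support, whereas a success
  possible after a reachable state would extend to a path in the support.\<close>

lemma blocking_step_reach:
  assumes "has_blocking_step obs n \<pi>"
  shows "\<exists>r. \<forall>st\<in>reach obs n (\<lambda>_. \<pi>) r. blocked n (\<lambda>_. \<pi>) st"
proof -
  obtain r where r: "\<And>i. i < n \<Longrightarrow> measure_pmf.prob (paths obs n (\<lambda>_. \<pi>) (Suc r))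
                   {p. (p ! r) i \<noteq> None \<and> (p ! Suc r) i = None} = 0"
    using assms unfolding has_blocking_step_def by blast
  have "blocked n (\<lambda>_. \<pi>) st" if st: "st \<in> reach obs n (\<lambda>_. \<pi>) r" for st
    unfolding blocked_def
  proof (intro ballI allI notI)
    fix a i assume a: "a \<in> set_pmf (joint_action n (\<lambda>_. \<pi>) st)" and succ: "succeeds (pending n st) a i"
    obtain p where p: "p \<in> set_pmf (paths obs n (\<lambda>_. \<pi>) r)" "last p = st"
      using st by (auto simp: reach_def)
    let ?q = "p @ [next_state obs n st a]"
    have "?q \<in> set_pmf (paths obs n (\<lambda>_. \<pi>) (Suc r))"
      using p a by (auto simp: step_eq)
    moreover have "(?q ! r) i \<noteq> None \<and> (?q ! Suc r) i = None"
      using p succ length_paths[OF p(1)] last_paths[OF p(1)]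
      by (auto simp: nth_append next_state_apply succeeds_def pending_def)
    moreover have "i < n" using succ by (auto simp: succeeds_def pending_def)
    ultimately show False using r[of i] unfolding measure_pmf_zero_iff by blast
  qed
  then show ?thesis by blast
qed

lemma uniform_blocked_deterministic:
  assumes B: "B \<subseteq> {..<n}" "2 \<le> card B" and bl: "blocked n (\<lambda>_. \<pi>) (uniform_state B h)"
  obtains a where "\<pi> h = return_pmf a"
proof -
  obtain a where a: "a \<in> set_pmf (\<pi> h)" using set_pmf_not_empty by fastforce
  have "b = a" if b: "b \<in> set_pmf (\<pi> h)" for b
  proof (rule ccontr)
    assume "b \<noteq> a"
    \<comment> \<open>Of two distinct actions at least one is a channel; call it \<open>x\<close>.
      One player on \<open>x\<close> and the rest on \<open>y\<close> is then a possible
      success.\<close>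
    then obtain x y where xy: "x \<in> set_pmf (\<pi> h)" "y \<in> set_pmf (\<pi> h)" "x \<noteq> 0" "y \<noteq> x"
      using a b by (metis (no_types))
    obtain i where i: "i \<in> B" using B(2) by fastforce
    let ?a = "\<lambda>j. if j \<in> B then if j = i then x else y else 0"
    have "?a \<in> set_pmf (joint_action n (\<lambda>_. \<pi>) (uniform_state B h))"
      using xy i B(1) by (auto simp: set_joint_action_uniform)
    moreover have "succeeds B ?a i" using xy i by (auto simp: succeeds_def)
    ultimately show False using bl B by (auto simp: blocked_def)
  qed
  then have "set_pmf (\<pi> h) \<subseteq> {a}" by blast
  then show ?thesis using that by (auto simp: set_pmf_subset_singleton)
qed

lemma surv_blocked:
  assumes "blocked n P st" "i \<in> pending n st"
  shows "surv obs n P i (Suc 0) st = 1"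
proof -
  have "surv obs n P i (Suc 0) st = (\<integral>\<^sup>+ a. 1 \<partial>measure_pmf (joint_action n P st))"
    unfolding surv.simps using assms
    by (intro nn_integral_cong_AE) (auto simp: AE_measure_pmf_iff blocked_def next_state_apply)
  then show ?thesis by (simp add: measure_pmf.emeasure_space_1)
qed

text \<open>All others in \<open>B\<close> play \<open>a\<close> for certain, so \<open>c\<close> is
  free; a departed player never returns, which covers every \<open>u\<close>.\<close>

lemma surv_escape:
  assumes B: "B \<subseteq> {..<n}" "i \<in> B" and a: "\<pi> h = return_pmf a"
    and c: "P i h = return_pmf c" "c \<noteq> 0" "c \<noteq> a" and P: "\<And>j. j \<noteq> i \<Longrightarrow> P j = \<pi>"
  shows "surv obs n P i (Suc u) (uniform_state B h) = 0"
proof -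
  have "next_state obs n (uniform_state B h) f i = None"
    if "f \<in> set_pmf (joint_action n P (uniform_state B h))" for f
  proof -
    have f: "f j \<in> set_pmf (P j h)" if "j \<in> B" for j
      using \<open>f \<in> _\<close> that B(1) by (simp add: set_joint_action_uniform)
    have "f i = c" using f[OF B(2)] by (simp add: c(1))
    moreover have "f j = a" if "j \<in> B" "j \<noteq> i" for j using f[OF that(1)] by (simp add: P[OF that(2)] a)
    ultimately have "succeeds B f i" using c B by (simp add: succeeds_def)
    then show ?thesis using B by (simp add: next_state_apply)
  qed
  then show ?thesis
    by (simp add: nn_integral_0_iff_AE AE_measure_pmf_iff surv_departed)
qed

text \<open>At most one of the channels 1 and 2 equals \<open>a\<close>; this is where
  \<open>k \<ge> 2\<close> enters.\<close>

lemma escape_channel: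
  assumes "k \<ge> (2::nat)"
  obtains c where "c \<noteq> 0" "c \<noteq> a" "c \<le> k"
proof (cases "a = 1")
  case True
  then show ?thesis using that[of 2] assms by auto
next
  case False
  then show ?thesis using that[of 1] assms by auto
qed

section \<open>Acknowledgement-based protocols\<close>

text \<open>If all players happen to choose the same possible action, they collide or stay silent,
  and their histories remain equal.\<close>

lemma full_uniform_reachable:
  assumes "n \<ge> 2"
  shows "\<exists>h. uniform_state {..<n} h \<in> reach obs n (\<lambda>_. \<pi>) t"
proof (induction t)
  case 0
  show ?case by (auto simp: reach_0 init_state_uniform)
next
  case (Suc t)
  then obtain h where h: "uniform_state {..<n} h \<in> reach obs n (\<lambda>_. \<pi>) t" by blast
  obtain z where z: "z \<in> set_pmf (\<pi> h)" using set_pmf_not_empty by fastforce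
  define a where "a = (\<lambda>i. if i < n then z else 0)"
  have a: "a \<in> set_pmf (joint_action n (\<lambda>_. \<pi>) (uniform_state {..<n} h))"
    using z by (simp add: set_joint_action_uniform a_def)
  have fail: "\<not> succeeds {..<n} a i" for i
  proof
    assume "succeeds {..<n} a i"
    then have i: "i < n" and "\<And>j. j < n \<Longrightarrow> j \<noteq> i \<Longrightarrow> a j \<noteq> a i" by (auto simp: succeeds_def)
    then have "j = i" if "j < n" for j using that by (auto simp: a_def)
    from this[of 0] this[of 1] show False using assms by simp
  qed
  have "next_state obs n (uniform_state {..<n} h) a = uniform_state {..<n} (h @ [obs z n])"
    by (auto simp: next_state_apply fail fun_eq_iff uniform_state_def[of _ "h @ _"])
       (auto simp: uniform_state_def a_def)
  with h a show ?case by (auto simp: reach_Suc intro: exI[of _ "h @ [obs z n]"]) metis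
qed

text \<open>The coupling behind this lemma: a removed player can only turn other players' collisions into
  successes, so the smaller set of pending players stays the smaller one.\<close>

lemma surv_ack_mono:
  assumes "\<And>l h'. st' l = Some h' \<Longrightarrow> \<exists>h. st l = Some h \<and> (\<forall>x. P' l (h' @ x) = P l (h @ x))"
  shows "surv obs_ack n P' i u st' \<le> surv obs_ack n P i u st"
  using assms
proof (induction u arbitrary: st st')
  case 0
  then show ?case by fastforce
next
  case (Suc u)
  let ?A = "pending n st" and ?A' = "pending n st'"
  let ?res = "\<lambda>f l. if l \<in> ?A' then f l else 0"
  have sub: "?A' \<subseteq> ?A" using Suc.prems by (fastforce simp: pending_def)
  have "P' l (the (st' l)) = P l (the (st l))" if l: "l \<in> ?A'" for l
  proof -
    obtain h' where h': "st' l = Some h'" using l by (auto simp: pending_def)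
    then obtain h where "st l = Some h" "P' l (h' @ []) = P l (h @ [])" using Suc.prems by blast
    then show ?thesis using h' by simp
  qed
  \<comment> \<open>Rules agree on paired histories, so restricting a draw \<open>f\<close> for
    \<open>st\<close> to the smaller pending set gives a draw for \<open>st'\<close>: one
    \<open>f\<close> drives both sides.\<close>
  then have "joint_action n P' st' = Pi_pmf ?A' 0 (\<lambda>l. P l (the (st l)))"
    unfolding joint_action_def by (intro Pi_pmf_cong) auto
  also have "\<dots> = map_pmf ?res (joint_action n P st)"
    unfolding joint_action_def by (rule Pi_pmf_subset) (use sub in auto)
  finally have joint: "joint_action n P' st' = map_pmf ?res (joint_action n P st)" .
  have "surv obs_ack n P' i u (next_state obs_ack n st' (?res f)) \<le>
        surv obs_ack n P i u (next_state obs_ack n st f)" for f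
  proof (rule Suc.IH)
    fix l h' assume next': "next_state obs_ack n st' (?res f) l = Some h'"
    then have l: "l \<in> ?A'" and fail: "\<not> succeeds ?A' (?res f) l"
      and h': "h' = the (st' l) @ [f l]"
      by (auto simp: next_state_apply obs_ack_def split: if_splits)
    have "\<not> succeeds ?A f l" using fail l sub by (auto simp: succeeds_def)
    \<comment> \<open>With \<open>obs_ack\<close> the new entry is \<open>f l\<close> on both sides,
      even if different numbers of players remain, so paired histories stay paired.\<close>
    then have *: "next_state obs_ack n st f l = Some (the (st l) @ [f l])"
      using l sub by (auto simp: next_state_apply obs_ack_def)
    obtain g' where g': "st' l = Some g'" using l by (auto simp: pending_def)
    then obtain g where "st l = Some g" "\<And>x. P' l (g' @ x) = P l (g @ x)" using Suc.prems by blast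
    then show "\<exists>h. next_state obs_ack n st f l = Some h \<and> (\<forall>x. P' l (h' @ x) = P l (h @ x))"
      using * h' g' by simp
  qed
  then show ?case by (simp add: joint nn_integral_mono)
qed

text \<open>One-slot coupling: by independence, all actions can be drawn under \<open>P\<close> and
  that of player \<open>i\<close> overwritten.\<close>

lemma joint_action_fix:
  assumes i: "i \<in> pending n st" and c: "P' i (the (st i)) = return_pmf c"
    and P': "\<And>j. j \<noteq> i \<Longrightarrow> P' j = P j"
  shows "joint_action n P' st = map_pmf (\<lambda>f. f(i := c)) (joint_action n P st)"
proof -
  let ?A = "pending n st" and ?p = "\<lambda>l. P l (the (st l))" and ?p' = "\<lambda>l. P' l (the (st l))"
  have "joint_action n P' st = Pi_pmf (insert i (?A - {i})) 0 ?p'"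
    using i by (simp add: joint_action_def insert_absorb)
  also have "\<dots> = map_pmf (\<lambda>f. f(i := c)) (Pi_pmf (?A - {i}) 0 ?p')"
    by (subst Pi_pmf_insert') (auto simp: c bind_return_pmf map_pmf_def)
  also have "Pi_pmf (?A - {i}) 0 ?p' = Pi_pmf (?A - {i}) 0 ?p"
    by (intro Pi_pmf_cong) (auto simp: P')
  also have "\<dots> = map_pmf (\<lambda>f. f(i := 0)) (joint_action n P st)"
    unfolding joint_action_def by (rule Pi_pmf_remove) simp
  finally show ?thesis by (simp add: map_pmf_comp del: fun_upd_apply)
qed

lemma no_ack_EBS:
  assumes "k \<ge> 2" "n \<ge> 2" and ebs: "is_EBS obs_ack n k \<pi>"
    and fin: "\<And>i. i < n \<Longrightarrow> expected_latency obs_ack n (\<lambda>_. \<pi>) i < \<infinity>"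
  shows False
proof -
  have eq: "is_equilibrium obs_ack n k \<pi>" and "has_blocking_step obs_ack n \<pi>"
    using ebs by (auto simp: is_EBS_def)
  then obtain r where "\<forall>st\<in>reach obs_ack n (\<lambda>_. \<pi>) r. blocked n (\<lambda>_. \<pi>) st"
    using blocking_step_reach by blast
  note bl = bspec[OF this]
  obtain h where st: "uniform_state {..<n} h \<in> reach obs_ack n (\<lambda>_. \<pi>) r"
    using full_uniform_reachable \<open>n \<ge> 2\<close> by blast
  obtain a where a: "\<pi> h = return_pmf a"
    using uniform_blocked_deterministic[OF _ _ bl[OF st]] \<open>n \<ge> 2\<close> by auto
  obtain c where c: "c \<noteq> 0" "c \<noteq> a" "c \<le> k" using escape_channel \<open>k \<ge> 2\<close> by blast
  have st0: "uniform_state {..<n} h 0 = Some h" using \<open>n \<ge> 2\<close> by (simp add: uniform_state_def)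
  have len: "length h = r" using reach_history[OF st st0] by simp
  \<comment> \<open>After the escape attempt the player pretends to have played \<open>a\<close>.\<close>
  define \<sigma> where "\<sigma> = (\<lambda>x. if x = h then return_pmf c else \<pi> (h @ a # drop (Suc r) x))"
  define P' :: "nat profile" where "P' = (\<lambda>_. \<pi>)(0 := deviate \<pi> \<sigma> r)"
  have \<sigma>: "valid_rule k \<sigma>" using eq c(3) by (auto simp: valid_rule_def is_equilibrium_def \<sigma>_def)
  have P'h: "P' 0 h = return_pmf c" by (simp add: P'_def deviate_def len \<sigma>_def)
  have P'_ext: "P' 0 ((h @ [c]) @ x) = \<pi> ((h @ [a]) @ x)" for x
    by (simp add: P'_def deviate_def len[symmetric] \<sigma>_def)
  have P'_other: "P' j = \<pi>" if "j \<noteq> 0" for j using that by (simp add: P'_def)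
  \<comment> \<open>In a general \<open>st\<close> compatible with \<open>h\<close>, channel
    \<open>c\<close> may be occupied; the deviation is therefore coupled with the original play
    through the same draw \<open>f\<close>.\<close>
  have le: "surv obs_ack n P' 0 u st \<le> surv obs_ack n (\<lambda>_. \<pi>) 0 u st"
    if st: "st \<in> reach obs_ack n (\<lambda>_. \<pi>) r" "st 0 = Some h" for st u
  proof (cases u)
    case (Suc v)
    have pend: "0 \<in> pending n st" using st(2) \<open>n \<ge> 2\<close> by (auto simp: pending_def)
    have "surv obs_ack n P' 0 v (next_state obs_ack n st (f(0 := c))) \<le>
          surv obs_ack n (\<lambda>_. \<pi>) 0 v (next_state obs_ack n st f)"
      if f: "f \<in> set_pmf (joint_action n (\<lambda>_. \<pi>) st)" for f
    proof (rule surv_ack_mono)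
      fix l h' assume "next_state obs_ack n st (f(0 := c)) l = Some h'"
      then have l: "l \<in> pending n st" and h': "h' = the (st l) @ [(f(0 := c)) l]"
        by (auto simp: next_state_apply obs_ack_def split: if_splits)
      \<comment> \<open>As \<open>st\<close> is blocked, nobody leaves under \<open>f\<close>, so
        whoever remains after the deviation has a counterpart.\<close>
      have *: "next_state obs_ack n st f l = Some (the (st l) @ [f l])"
        using l bl[OF st(1)] f by (simp add: next_state_apply obs_ack_def blocked_def)
      show "\<exists>h. next_state obs_ack n st f l = Some h \<and> (\<forall>x. P' l (h' @ x) = \<pi> (h @ x))"
      proof (cases "l = 0")
        case True
        have "f 0 \<in> set_pmf (\<pi> h)" using f pend st(2) by (force simp: set_joint_action)
        then show ?thesis using True * h' st(2) P'_ext a by simp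
      next
        case False
        then show ?thesis using * h' P'_other by simp
      qed
    qed
    moreover have "joint_action n P' st = map_pmf (\<lambda>f. f(0 := c)) (joint_action n (\<lambda>_. \<pi>) st)"
      by (rule joint_action_fix[OF pend]) (use st(2) P'h P'_other in auto)
    ultimately show ?thesis
      by (auto simp: Suc AE_measure_pmf_iff intro!: nn_integral_mono_AE)
  qed simp
  have "surv obs_ack n (\<lambda>_. \<pi>) 0 (Suc 0) (uniform_state {..<n} h) \<le>
        surv obs_ack n P' 0 (Suc 0) (uniform_state {..<n} h)"
    using \<open>n \<ge> 2\<close> by (intro no_profitable_deviation[OF eq fin \<sigma> P'_def le st st0]) auto
  moreover have "surv obs_ack n (\<lambda>_. \<pi>) 0 (Suc 0) (uniform_state {..<n} h) = 1"
    using \<open>n \<ge> 2\<close> by (intro surv_blocked bl st) simp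
  moreover have "surv obs_ack n P' 0 (Suc 0) (uniform_state {..<n} h) = 0"
    by (rule surv_escape[where \<pi> = \<pi> and a = a and c = c]) (use a P'h c P'_other \<open>n \<ge> 2\<close> in auto)
  ultimately show False by simp
qed

section \<open>Ternary feedback\<close>

text \<open>The succeeding players get distinct channels from \<open>S - {z}\<close>, the others all
  get \<open>z\<close>. Capping \<open>j\<close> at \<open>card B - 2\<close> leaves at least two on
  \<open>z\<close>, who all fail.\<close>

lemma uniform_split:
  assumes m: "card B \<ge> 2" "finite B" and S: "finite S" "S \<noteq> {}"
  obtains a z j where "z \<in> S" "0 \<in> S \<longrightarrow> z = 0" "j = card (S - {z}) \<or> j = card B - 2"
    "j + 2 \<le> card B" "\<forall>i\<in>B. a i \<in> S" "\<forall>i. i \<notin> B \<longrightarrow> a i = (0::nat)"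
    "\<forall>i\<in>B. \<not> succeeds B a i \<longrightarrow> a i = z" "card {i \<in> B. \<not> succeeds B a i} = card B - j"
proof -
  obtain z where z: "z \<in> S" "0 \<in> S \<longrightarrow> z = 0" using S(2) by auto
  define j where "j = min (card (S - {z})) (card B - 2)"
  obtain X where X: "X \<subseteq> S - {z}" "card X = j" "finite X"
    using obtain_subset_with_card_n[of j "S - {z}"] by (auto simp: j_def)
  have "j \<le> card B" by (simp add: j_def)
  then obtain C where C: "C \<subseteq> B" "card C = j" "finite C"
    using obtain_subset_with_card_n by metis
  obtain g where g: "bij_betw g C X" using finite_same_card_bij X C by metis
  define a where "a = (\<lambda>i. if i \<in> C then g i else if i \<in> B then z else 0)"
  \<comment> \<open>Since \<open>z = 0\<close> whenever \<open>0\<close> lies in \<open>S\<close>,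
    removing \<open>z\<close> leaves genuine channels only.\<close>
  have g_S: "g i \<in> S \<and> g i \<noteq> z \<and> g i \<noteq> 0" if "i \<in> C" for i
  proof -
    have "g i \<in> S - {z}" using that g X(1) bij_betwE by blast
    then show ?thesis using z by (cases "g i = 0") auto
  qed
  have inj: "i \<in> C \<Longrightarrow> l \<in> C \<Longrightarrow> g i = g l \<Longrightarrow> i = l" for i l
    using g by (auto simp: bij_betw_def inj_on_def)
  have j2: "j + 2 \<le> card B" using m by (simp add: j_def)
  have cardBC: "card (B - C) = card B - j" using C m by (simp add: card_Diff_subset)
  have succ: "succeeds B a i" if "i \<in> C" for i
    using that g_S[OF that] C(1) inj[OF _ that] by (auto simp: succeeds_def a_def)
  have fail: "\<not> succeeds B a i" if i: "i \<in> B - C" for i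
  proof -
    have "card (B - C - {i}) \<ge> 1" using cardBC j2 i m by (simp add: card_Diff_singleton_if)
    then have "B - C - {i} \<noteq> {}" by (metis card.empty not_one_le_zero)
    then obtain l where "l \<in> B - C - {i}" by blast
    then show ?thesis using i by (auto simp: succeeds_def a_def)
  qed
  have "succeeds B a i \<longleftrightarrow> i \<in> C" if "i \<in> B" for i
    using succ fail that by (cases "i \<in> C") simp_all
  then have "{i \<in> B. \<not> succeeds B a i} = B - C" by auto
  then have failures: "card {i \<in> B. \<not> succeeds B a i} = card B - j" using cardBC by simp
  show ?thesis
  proof (rule that[OF z _ j2 _ _ _ failures])
    show "j = card (S - {z}) \<or> j = card B - 2" by (simp add: j_def min_def)
    show "\<forall>i\<in>B. a i \<in> S" using g_S z(1) by (simp add: a_def)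
    show "\<forall>i. i \<notin> B \<longrightarrow> a i = 0" using C(1) by (auto simp: a_def)
    show "\<forall>i\<in>B. \<not> succeeds B a i \<longrightarrow> a i = z" using succ by (auto simp: a_def)
  qed
qed

text \<open>Either the successes use up every channel of \<open>S\<close> other than \<open>z\<close>, or just two players are left,
  who must have collided with each other (or both been silent).\<close>

lemma uniform_split_revealed:
  assumes B: "finite B" and S: "finite S" and z: "0 \<in> S \<longrightarrow> z = 0"
    and a: "\<And>l. l \<in> B \<Longrightarrow> a l \<in> S"
    and j: "j = card (S - {z}) \<or> j = card B - 2" "j + 2 \<le> card B"
    and F: "F = {l \<in> B. \<not> succeeds B a l}" "card F = card B - j"
    and i: "i \<in> F" "a i = z" and l: "l \<in> F"
  shows "a l = z"
proof (rule ccontr)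
  assume l_z: "a l \<noteq> z"
  \<comment> \<open>A failing player off \<open>z\<close> cannot be silent, hence has a collision
    partner \<open>q\<close>, who fails as well.\<close>
  have "a l \<noteq> 0" using a[of l] l z l_z F(1) by (cases "a l = 0") auto
  then obtain q where q: "q \<in> B" "q \<noteq> l" "a q = a l" using l by (auto simp: F(1) succeeds_def)
  have qF: "q \<in> F" using q l by (auto simp: F(1) succeeds_def)
  have qi: "q \<noteq> i" using q i l_z by auto
  have li: "l \<noteq> i" using l_z i by auto
  from j(1) show False
  proof
    assume "j = card B - 2"
    then have "card F = 2" using F(2) j(2) by simp
    moreover have "card {i, l, q} \<le> card F" using i l qF B F(1) by (intro card_mono) auto
    ultimately show False using q qi li by simp
  next
    assume jS: "j = card (S - {z})"
    let ?G = "B - F"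
    \<comment> \<open>The successful players occupy \<open>j\<close> distinct channels, none of them
      \<open>z\<close> because \<open>i\<close> plays it. They exhaust \<open>S - {z}\<close>, so
      one of them would share the action of \<open>l\<close>.\<close>
    have "inj_on a ?G" by (auto simp: inj_on_def F(1) succeeds_def)
    moreover have "card ?G = j" using F B j(2) by (subst card_Diff_subset) (auto simp: F(1))
    ultimately have card_G: "card (a ` ?G) = card (S - {z})" using jS by (simp add: card_image)
    have "a g \<noteq> z" if g: "g \<in> ?G" for g
    proof -
      have "g \<noteq> i" "succeeds B a g" "i \<in> B" using g i(1) by (auto simp: F(1))
      then show ?thesis using i(2) by (auto simp: succeeds_def)
    qed
    then have "a ` ?G \<subseteq> S - {z}" using a by auto
    then have "a ` ?G = S - {z}" using S card_G by (intro card_subset_eq) auto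
    moreover have "a l \<in> S - {z}" using a l l_z F(1) by auto
    ultimately obtain g where "g \<in> ?G" "a g = a l" by (metis imageE)
    then show False using l unfolding F(1) succeeds_def by auto metis
  qed
qed

text \<open>The invariant ranges over all reachable states: \<open>h\<close> reveals that all
  pending players hold it and how many they are, but not who (\<open>B'\<close>). A slot built by
  \<open>uniform_split\<close> preserves it, thanks to
  \<open>uniform_split_revealed\<close>.\<close>

lemma revealing_uniform_reachable:
  assumes n: "n \<ge> 2" and valid: "valid_rule k \<pi>"
  shows "\<exists>B h. B \<subseteq> {..<n} \<and> 2 \<le> card B \<and> uniform_state B h \<in> reach obs_tern n (\<lambda>_. \<pi>) t \<and>
    (\<forall>st\<in>reach obs_tern n (\<lambda>_. \<pi>) t. \<forall>i. st i = Some h \<longrightarrow>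
       (\<exists>B'\<subseteq>{..<n}. i \<in> B' \<and> card B' = card B \<and> st = uniform_state B' h))"
proof (induction t)
  case 0
  have "\<forall>i. uniform_state {..<n} [] i = Some [] \<longrightarrow> i < n" by (simp add: uniform_state_def)
  then show ?case using n
    by (intro exI[of _ "{..<n}"] exI[of _ "[]"]) (auto simp: reach_0 init_state_uniform)
next
  case (Suc t)
  then obtain B h where B: "B \<subseteq> {..<n}" "2 \<le> card B"
    and reach: "uniform_state B h \<in> reach obs_tern n (\<lambda>_. \<pi>) t"
    and reveal: "\<And>st i. st \<in> reach obs_tern n (\<lambda>_. \<pi>) t \<Longrightarrow> st i = Some h \<Longrightarrow>
       \<exists>B'\<subseteq>{..<n}. i \<in> B' \<and> card B' = card B \<and> st = uniform_state B' h" by blast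
  define S where "S = set_pmf (\<pi> h)"
  have S: "finite S" "S \<noteq> {}"
    using valid finite_subset[of S "{0..k}"] set_pmf_not_empty by (auto simp: valid_rule_def S_def)
  have finB: "finite B" using B(1) finite_subset by blast
  obtain a z j where split: "z \<in> S" "0 \<in> S \<longrightarrow> z = 0" "j = card (S - {z}) \<or> j = card B - 2"
    "j + 2 \<le> card B" "\<forall>i\<in>B. a i \<in> S" "\<forall>i. i \<notin> B \<longrightarrow> a i = 0"
    "\<forall>i\<in>B. \<not> succeeds B a i \<longrightarrow> a i = z" "card {i \<in> B. \<not> succeeds B a i} = card B - j"
    by (rule uniform_split[OF B(2) finB S]) (rule that)
  let ?F = "{i \<in> B. \<not> succeeds B a i}" and ?h = "h @ [(z, card B - j)]"
  have next_uniform: "next_state obs_tern n (uniform_state C h) f =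
      uniform_state {l \<in> C. \<not> succeeds C f l} (h @ [(z, card {l \<in> C. \<not> succeeds C f l})])"
    if "C \<subseteq> {..<n}" "\<And>l. l \<in> C \<Longrightarrow> \<not> succeeds C f l \<Longrightarrow> f l = z" for C f
    using that(2) unfolding fun_eq_iff next_state_apply pending_uniform[OF that(1)]
    by (auto simp: uniform_state_def obs_tern_def)
  have "a \<in> set_pmf (joint_action n (\<lambda>_. \<pi>) (uniform_state B h))"
    using split B(1) by (simp add: set_joint_action_uniform S_def)
  then have "next_state obs_tern n (uniform_state B h) a \<in> reach obs_tern n (\<lambda>_. \<pi>) (Suc t)"
    using reach unfolding reach_Suc by blast
  then have "uniform_state ?F ?h \<in> reach obs_tern n (\<lambda>_. \<pi>) (Suc t)"
    using next_uniform[OF B(1), of a] split(7,8) by simp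
  moreover have "\<exists>B'\<subseteq>{..<n}. i \<in> B' \<and> card B' = card ?F \<and> st = uniform_state B' ?h"
    if st: "st \<in> reach obs_tern n (\<lambda>_. \<pi>) (Suc t)" "st i = Some ?h" for st i
  proof -
    obtain st' f where st': "st' \<in> reach obs_tern n (\<lambda>_. \<pi>) t"
      and f: "f \<in> set_pmf (joint_action n (\<lambda>_. \<pi>) st')" and st_eq: "st = next_state obs_tern n st' f"
      using st(1) by (auto simp: reach_Suc)
    \<comment> \<open>The last entry of \<open>?h\<close> records that \<open>i\<close> chose
      \<open>z\<close> and that \<open>card B - j\<close> players remain.\<close>
    have i: "i \<in> pending n st'" "\<not> succeeds (pending n st') f i" "the (st' i) = h" "f i = z"
      "card {l \<in> pending n st'. \<not> succeeds (pending n st') f l} = card B - j"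
      using st(2) by (auto simp: st_eq next_state_apply obs_tern_def split: if_splits)
    then have "st' i = Some h" by (auto simp: pending_def)
    then obtain C where C: "C \<subseteq> {..<n}" "i \<in> C" "card C = card B" "st' = uniform_state C h"
      using reveal st' by blast
    let ?E = "{l \<in> C. \<not> succeeds C f l}"
    have pend: "pending n st' = C" using C by simp
    have f_S: "f l \<in> S" if "l \<in> C" for l
      using f that C(1) by (simp add: C(4) set_joint_action_uniform S_def)
    have "f l = z" if "l \<in> C" "\<not> succeeds C f l" for l
      by (rule uniform_split_revealed[of C S z f j ?E i l])
        (use that f_S i C split pend S finite_subset[OF C(1)] in auto)
    then have "st = uniform_state ?E ?h"
      using next_uniform[OF C(1), of f] i(5) by (simp add: st_eq C(4) C(1))
    then show ?thesis using C i pend split(8) by (intro exI[of _ ?E]) auto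
  qed
  ultimately show ?case using B split(4,8)
    by (intro exI[of _ ?F] exI[of _ ?h]) auto
qed

lemma no_tern_EBS:
  assumes "k \<ge> 2" "n \<ge> 2" and ebs: "is_EBS obs_tern n k \<pi>"
    and fin: "\<And>i. i < n \<Longrightarrow> expected_latency obs_tern n (\<lambda>_. \<pi>) i < \<infinity>"
  shows False
proof -
  have eq: "is_equilibrium obs_tern n k \<pi>" and "has_blocking_step obs_tern n \<pi>"
    using ebs by (auto simp: is_EBS_def)
  then obtain r where "\<forall>st\<in>reach obs_tern n (\<lambda>_. \<pi>) r. blocked n (\<lambda>_. \<pi>) st"
    using blocking_step_reach by blast
  note bl = bspec[OF this]
  have "valid_rule k \<pi>" using eq by (simp add: is_equilibrium_def)
  then obtain B h where B: "B \<subseteq> {..<n}" "2 \<le> card B"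
    and st: "uniform_state B h \<in> reach obs_tern n (\<lambda>_. \<pi>) r"
    and reveal: "\<And>st i. st \<in> reach obs_tern n (\<lambda>_. \<pi>) r \<Longrightarrow> st i = Some h \<Longrightarrow>
       \<exists>B'\<subseteq>{..<n}. i \<in> B' \<and> card B' = card B \<and> st = uniform_state B' h"
    using revealing_uniform_reachable[OF \<open>n \<ge> 2\<close>, of k \<pi> r] by metis
  obtain i where i: "i \<in> B" using B(2) by fastforce
  obtain a where a: "\<pi> h = return_pmf a"
    using uniform_blocked_deterministic[OF B bl[OF st]] by blast
  obtain c where c: "c \<noteq> 0" "c \<noteq> a" "c \<le> k" using escape_channel \<open>k \<ge> 2\<close> by blast
  have sti: "uniform_state B h i = Some h" using i by (simp add: uniform_state_def)
  have len: "length h = r" using reach_history[OF st sti] by simp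
  \<comment> \<open>Given \<open>h\<close>, the escape on \<open>c\<close> succeeds at once for
    certain, so a constant rule is enough.\<close>
  define \<sigma> :: "(nat \<times> nat) list \<Rightarrow> nat pmf" where "\<sigma> = (\<lambda>_. return_pmf c)"
  define P' where "P' = (\<lambda>_. \<pi>)(i := deviate \<pi> \<sigma> r)"
  have \<sigma>: "valid_rule k \<sigma>" using c(3) by (simp add: valid_rule_def \<sigma>_def)
  have P'h: "P' i h = return_pmf c" by (simp add: P'_def deviate_def len \<sigma>_def)
  have P'_other: "P' j = \<pi>" if "j \<noteq> i" for j using that by (simp add: P'_def)
  have escape: "surv obs_tern n P' i (Suc u) (uniform_state C h) = 0"
    if "C \<subseteq> {..<n}" "i \<in> C" for u C
    by (rule surv_escape[where \<pi> = \<pi> and a = a and c = c]) (use that a P'h c P'_other in auto)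
  have le: "surv obs_tern n P' i u st \<le> surv obs_tern n (\<lambda>_. \<pi>) i u st"
    if st': "st \<in> reach obs_tern n (\<lambda>_. \<pi>) r" "st i = Some h" for st u
  proof (cases u)
    case (Suc v)
    obtain C where "C \<subseteq> {..<n}" "i \<in> C" "st = uniform_state C h" using reveal[OF st'] by blast
    then show ?thesis using escape Suc by (simp del: surv.simps)
  qed simp
  have "surv obs_tern n (\<lambda>_. \<pi>) i (Suc 0) (uniform_state B h) \<le>
        surv obs_tern n P' i (Suc 0) (uniform_state B h)"
    using B i by (intro no_profitable_deviation[OF eq fin \<sigma> P'_def le st sti]) auto
  moreover have "surv obs_tern n (\<lambda>_. \<pi>) i (Suc 0) (uniform_state B h) = 1"
    using B i by (intro surv_blocked bl st) simp
  ultimately show False using escape[OF B(1) i, of 0] by simp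
qed

theorem theorem7:
  fixes n k :: nat
  assumes "k \<ge> 2" and "n \<ge> 2"
  shows "(\<not> (\<exists>\<pi> :: nat list \<Rightarrow> nat pmf.
             is_EBS obs_ack n k \<pi> \<and> (\<forall>i<n. expected_latency obs_ack n (\<lambda>_. \<pi>) i < \<infinity>)))
       \<and> (\<not> (\<exists>\<pi> :: (nat \<times> nat) list \<Rightarrow> nat pmf.
             is_EBS obs_tern n k \<pi> \<and> (\<forall>i<n. expected_latency obs_tern n (\<lambda>_. \<pi>) i < \<infinity>)))"
  using no_ack_EBS[OF assms] no_tern_EBS[OF assms] by blast

end
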